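(* Let $A=(a_{i,j})\in\mathcal M_n(\mathbb R)$ be a square matrix such that $a_{i,j}\ge0$ for all $i,j\in[n]$, and let $b\in\mathbb R_{++}^n$. If there exists a permutation $\sigma:[n]\to[n]$ such that for all $i\in[n]$ we have $a_{i,\sigma(i)}>0$ and $$b_i>\max_{j\in[n]\setminus\{i\}}a_{i,\sigma(j)}\frac{b_j}{a_{j,\sigma(j)}},$$ then $|A|_\infty\ne0$. Moreover, $x^\star=\sum_{i\in[n]}\frac{|A^{(i)}|_\infty}{|A|_\infty}e_i\in\mathbb R_+^n$ is a solution to the system of maximum equations $$\max\{a_{i,1}x_1,\dots,a_{i,n}x_n\}=b_i,\qquad i\in[n].$$ Conversely, suppose that $|A|_\infty\ne0$. If $x^\star=\sum_{i\in[n]}\frac{|A^{(i)}|_\infty}{|A|_\infty}e_i$ is the unique regular solution of the limit system $$A\stackrel{-}{\boxtimes}x\le b,\qquad A\stackrel{+}{\boxtimes}x\ge b,\qquad x\in\mathbb R^n,$$ then $x^\star$ is a nonnegative solution of the system of maximum equations $$\max\{a_{i,1}x_1,\dots,a_{i,n}x_n\}=b_i,\qquad i\in[n].$$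
   Context: $[n]=\{1,\dots,n\}$; $\mathbb R_+^n$ and $\mathbb R_{++}^n$ are the sets of vectors with nonnegative, respectively positive, components; $(e_i)$ is the canonical basis; vector inequalities are componentwise. $A^{(i)}$ is the matrix obtained from $A$ by replacing column $i$ with $b$. For a finite family of reals $(x_i)_{i\in I}$, with $\xi(\alpha)=\mathrm{Card}\{i:x_i=\alpha\}-\mathrm{Card}\{i:x_i=-\alpha\}$ for $\alpha>0$: $\mathop{\boxplus}_{i\in I}x_i=0$ if $\xi(\alpha)=0$ for all $\alpha>0$; otherwise, with $\alpha^\star$ the largest $\alpha>0$ such that $\xi(\alpha)\ne0$, $\mathop{\boxplus}_{i\in I}x_i=\alpha^\star$ if $\xi(\alpha^\star)>0$ and $-\alpha^\star$ if $\xi(\alpha^\star)<0$. Determinant in limit: $|A|_\infty=\mathop{\boxplus}_{\sigma\in S_n}\big(\operatorname{sgn}(\sigma)\prod_{i\in[n]}a_{i,\sigma(i)}\big)$. Binary associative operations on $\mathbb R$: $u\stackrel{\mp}{\smile}v$ equals $u$ if $|u|>|v|$, equals $v$ if $|u|<|v|$, and if $|u|=|v|$ then $u\stackrel{-}{\smile}v=\min\{u,v\}$, $u\stackrel{+}{\smile}v=\max\{u,v\}$. For $a,x\in\mathbb R^n$: $\langle a,x\rangle_\infty=\mathop{\boxplus}_{j\in[n]}a_jx_j$, $\langle a,x\rangle_\infty^{-}=a_1x_1\stackrel{-}{\smile}\cdots\stackrel{-}{\smile}a_nx_n$, $\langle a,x\rangle_\infty^{+}=a_1x_1\stackrel{+}{\smile}\cdots\stackrel{+}{\smile}a_nx_n$.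 With $a_i$ the $i$-th row of $A$, $A\stackrel{\mp}{\boxtimes}x$ is the vector with components $\langle a_i,x\rangle_\infty^{\mp}$. A solution $x^\star$ of the limit system is regular if $\langle a_i,x^\star\rangle_\infty=\langle a_i,x^\star\rangle_\infty^-=\langle a_i,x^\star\rangle_\infty^+$ for all $i\in[n]$. *)

theory Defs
  imports "HOL-Analysis.Analysis"
begin

definition xi :: "'i set \<Rightarrow> ('i \<Rightarrow> real) \<Rightarrow> real \<Rightarrow> int"
  where "xi I x \<alpha> = int (card {i \<in> I. x i = \<alpha>}) - int (card {i \<in> I. x i = - \<alpha>})"

text \<open>Meant for finite \<open>I\<close>; the set whose \<open>Max\<close> is taken is then finite.\<close>

definition boxplus :: "'i set \<Rightarrow> ('i \<Rightarrow> real) \<Rightarrow> real"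
  where "boxplus I x =
    (if \<forall>\<alpha>>0. xi I x \<alpha> = 0 then 0
     else let \<alpha>s = Max {\<alpha>. \<alpha> > 0 \<and> xi I x \<alpha> \<noteq> 0}
          in if xi I x \<alpha>s > 0 then \<alpha>s else - \<alpha>s)"

definition det_inf :: "real ^ 'n ^ 'n \<Rightarrow> real"
  where "det_inf A =
    boxplus {p. p permutes (UNIV :: 'n set)}
      (\<lambda>p. of_int (sign p) * (\<Prod>i\<in>UNIV. A $ i $ p i))"

definition replace_column :: "real ^ 'n ^ 'n \<Rightarrow> real ^ 'n \<Rightarrow> 'n \<Rightarrow> real ^ 'n ^ 'n"
  where "replace_column A b k = (\<chi> i j. if j = k then b $ i else A $ i $ j)"

definition cramer_inf :: "real ^ 'n ^ 'n \<Rightarrow> real ^ 'n \<Rightarrow> real ^ 'n"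
  where "cramer_inf A b =
    (\<Sum>i\<in>UNIV. (det_inf (replace_column A b i) / det_inf A) *\<^sub>R axis i 1)"

definition smile_minus :: "real \<Rightarrow> real \<Rightarrow> real"
  where "smile_minus u v =
    (if \<bar>u\<bar> > \<bar>v\<bar> then u else if \<bar>u\<bar> < \<bar>v\<bar> then v else min u v)"

definition smile_plus :: "real \<Rightarrow> real \<Rightarrow> real"
  where "smile_plus u v =
    (if \<bar>u\<bar> > \<bar>v\<bar> then u else if \<bar>u\<bar> < \<bar>v\<bar> then v else max u v)"

text \<open>Both operations are associative and commutative with neutral element \<open>0\<close>, so the
  iterated operation over a finite index set does not depend on an enumeration of it.\<close>

interpretation smile_minus: comm_monoid_set smile_minus 0
  by standard (smt (verit) smile_minus_def min_def)+

interpretation smile_plus: comm_monoid_set smile_plus 0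
  by standard (smt (verit) smile_plus_def max_def)+

definition inner_inf :: "real ^ 'n \<Rightarrow> real ^ 'n \<Rightarrow> real"
  where "inner_inf a x = boxplus UNIV (\<lambda>j. a $ j * x $ j)"

definition inner_minus :: "real ^ 'n \<Rightarrow> real ^ 'n \<Rightarrow> real"
  where "inner_minus a x = smile_minus.F (\<lambda>j. a $ j * x $ j) UNIV"

definition inner_plus :: "real ^ 'n \<Rightarrow> real ^ 'n \<Rightarrow> real"
  where "inner_plus a x = smile_plus.F (\<lambda>j. a $ j * x $ j) UNIV"

definition boxtimes_minus :: "real ^ 'n ^ 'm \<Rightarrow> real ^ 'n \<Rightarrow> real ^ 'm"
  where "boxtimes_minus A x = (\<chi> i. inner_minus (A $ i) x)"

definition boxtimes_plus :: "real ^ 'n ^ 'm \<Rightarrow> real ^ 'n \<Rightarrow> real ^ 'm"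
  where "boxtimes_plus A x = (\<chi> i. inner_plus (A $ i) x)"

text \<open>The order \<open>\<le>\<close> on vectors is the componentwise one.\<close>

definition limit_solution :: "real ^ 'n ^ 'n \<Rightarrow> real ^ 'n \<Rightarrow> real ^ 'n \<Rightarrow> bool"
  where "limit_solution A b x \<longleftrightarrow> boxtimes_minus A x \<le> b \<and> boxtimes_plus A x \<ge> b"

definition regular_solution :: "real ^ 'n ^ 'n \<Rightarrow> real ^ 'n \<Rightarrow> real ^ 'n \<Rightarrow> bool"
  where "regular_solution A b x \<longleftrightarrow> limit_solution A b x \<and>
    (\<forall>i. inner_inf (A $ i) x = inner_minus (A $ i) x \<and>
         inner_minus (A $ i) x = inner_plus (A $ i) x)"

definition max_solution :: "real ^ 'n ^ 'n \<Rightarrow> real ^ 'n \<Rightarrow> real ^ 'n \<Rightarrow> bool"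
  where "max_solution A b x \<longleftrightarrow> (\<forall>i. Max (range (\<lambda>j. A $ i $ j * x $ j)) = b $ i)"

end

theory Submission imports Defs begin

text \<open>Every quantity in the statement is a signed maximum: if a family contains a number
  \<open>c \<noteq> 0\<close>, has no entry of larger modulus, and does not contain \<open>- c\<close>, then \<open>\<boxplus>\<close> and both
  iterated smile operations return \<open>c\<close>. We say that \<open>c\<close> \<^emph>\<open>dominates\<close> such a family.

  For the first half, put \<open>x\<^bsub>\<sigma> j\<^esub> = b\<^sub>j / a\<^bsub>j,\<sigma> j\<^esub>\<close>. The hypothesis on \<open>\<sigma>\<close> says that, after
  multiplying column \<open>k\<close> by \<open>x\<^sub>k\<close>, the entry of row \<open>i\<close> in column \<open>\<sigma> i\<close> is \<open>b\<^sub>i\<close>, and all other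
  entries of that row are smaller. So \<open>x\<close> solves the max-equations, and \<open>\<sigma>\<close> is the only
  permutation that maximizes the product of entries: its signed term dominates the determinant,
  which is therefore \<open>sgn \<sigma> \<cdot> \<Prod>b / \<Prod>x\<close>. Replacing column \<open>k\<close> by \<open>b\<close> amounts to replacing
  the scaling factor \<open>x\<^sub>k\<close> by \<open>1\<close>, and \<open>\<sigma>\<close> remains the only maximizer, since two permutations
  cannot differ in exactly one place. The quotient of the two determinants is then \<open>x\<^sub>k\<close>, so the
  Cramer vector is \<open>x\<close>.

  For the converse, regularity squeezes \<open>b\<^sub>i\<close> between two equal values, so \<open>b\<^sub>i > 0\<close> dominates
  the products of row \<open>i\<close> and is in particular their maximum. As \<open>A \<ge> 0\<close>, replacing the negative
  components of a solution by \<open>0\<close> only replaces negative products by \<open>0\<close>, and \<open>b\<^sub>i\<close> still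
  dominates: the positive part of a regular solution is a regular solution, and uniqueness makes
  the two equal.\<close>

section \<open>Signed maxima and dominating entries\<close>

definition dominates :: "real \<Rightarrow> 'i set \<Rightarrow> ('i \<Rightarrow> real) \<Rightarrow> bool"
  where "dominates c I x \<longleftrightarrow>
    c \<noteq> 0 \<and> c \<in> x ` I \<and> - c \<notin> x ` I \<and> (\<forall>i\<in>I. \<bar>x i\<bar> \<le> \<bar>c\<bar>)"

text \<open>No modulus above \<open>\<bar>c\<bar>\<close> occurs, and at \<open>\<bar>c\<bar>\<close> only entries of one sign are counted, so
  nothing cancels.\<close>

lemma boxplus_eq_dominating:
  assumes "finite I" and dom: "dominates c I x"
  shows "boxplus I x = c"
proof -
  let ?S = "{\<alpha>. \<alpha> > 0 \<and> xi I x \<alpha> \<noteq> 0}"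
  from dom have c0: "c \<noteq> 0" and c: "c \<in> x ` I" and nc: "- c \<notin> x ` I"
    and le: "\<And>i. i \<in> I \<Longrightarrow> \<bar>x i\<bar> \<le> \<bar>c\<bar>"
    unfolding dominates_def by auto
  have "{i \<in> I. x i = - c} = {}"
    using nc by force
  then have none: "card {i \<in> I. x i = - c} = 0"
    by (simp only: card.empty)
  have some: "card {i \<in> I. x i = c} > 0"
    using c \<open>finite I\<close> by (auto simp: card_gt_0_iff)
  have xi_c: "if c > 0 then xi I x \<bar>c\<bar> > 0 else xi I x \<bar>c\<bar> < 0"
    using none some c0 by (cases "c > 0") (simp_all add: xi_def del: card_eq_0_iff card_0_eq)
  have above: "xi I x \<alpha> = 0" if "\<alpha> > \<bar>c\<bar>" for \<alpha>
  proof -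
    have "{i \<in> I. x i = \<alpha>} = {}" "{i \<in> I. x i = - \<alpha>} = {}"
      using le that by force+
    then show ?thesis by (simp only: xi_def)
  qed
  have in_S: "\<bar>c\<bar> \<in> ?S"
    using xi_c c0 by (auto split: if_splits)
  have "?S \<subseteq> (\<lambda>i. \<bar>x i\<bar>) ` I"
  proof
    fix \<alpha> assume \<alpha>: "\<alpha> \<in> ?S"
    then have "{i \<in> I. x i = \<alpha>} \<noteq> {i \<in> I. x i = - \<alpha>}"
      unfolding xi_def by force
    with \<alpha> show "\<alpha> \<in> (\<lambda>i. \<bar>x i\<bar>) ` I" by force
  qed
  then have "finite ?S"
    using \<open>finite I\<close> finite_surj by blast
  then have "Max ?S = \<bar>c\<bar>"
    using in_S above by (intro Max_eqI) (auto intro: leI)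
  moreover have "\<not> (\<forall>\<alpha>>0. xi I x \<alpha> = 0)"
    using in_S by blast
  ultimately show ?thesis
    using xi_c by (auto simp: boxplus_def Let_def split: if_splits)
qed

lemma smile_minus_select: "smile_minus u v \<in> {u, v}"
  by (simp add: smile_minus_def min_def)

lemma smile_plus_select: "smile_plus u v \<in> {u, v}"
  by (simp add: smile_plus_def max_def)

lemma smile_minus_in:
  assumes "finite I"
  shows "smile_minus.F f I \<in> insert 0 (f ` I)"
  using assms
proof induction
  case (insert i I)
  then show ?case using smile_minus_select[of "f i" "smile_minus.F f I"] by auto
qed simp

lemma smile_plus_in:
  assumes "finite I"
  shows "smile_plus.F f I \<in> insert 0 (f ` I)"
  using assms
proof induction
  case (insert i I)
  then show ?case using smile_plus_select[of "f i" "smile_plus.F f I"] by auto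
qed simp

text \<open>The operation \<open>smile_minus\<close> is the maximum for the total order that compares moduli
  first and puts \<open>- \<alpha>\<close> above \<open>\<alpha>\<close> in case of a tie, for \<open>\<alpha> > 0\<close>.\<close>

lemma smile_minus_bound:
  assumes "finite I" "i \<in> I"
  shows "\<bar>f i\<bar> < \<bar>smile_minus.F f I\<bar> \<or>
    \<bar>f i\<bar> = \<bar>smile_minus.F f I\<bar> \<and> smile_minus.F f I \<le> f i"
proof -
  obtain J where J: "I = insert i J" "i \<notin> J" "finite J"
    using assms by (metis Set.set_insert finite_insert)
  have "\<bar>u\<bar> < \<bar>smile_minus u v\<bar> \<or> \<bar>u\<bar> = \<bar>smile_minus u v\<bar> \<and> smile_minus u v \<le> u" for u v
    by (simp add: smile_minus_def min_def)
  then show ?thesis using J by (metis smile_minus.insert)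
qed

lemma smile_plus_bound:
  assumes "finite I" "i \<in> I"
  shows "\<bar>f i\<bar> \<le> \<bar>smile_plus.F f I\<bar>"
proof -
  obtain J where J: "I = insert i J" "i \<notin> J" "finite J"
    using assms by (metis Set.set_insert finite_insert)
  have "\<bar>u\<bar> \<le> \<bar>smile_plus u v\<bar>" for u v
    by (simp add: smile_plus_def max_def)
  then show ?thesis using J by (metis smile_plus.insert)
qed

lemma smile_minus_eq_dominating:
  assumes "finite I" "dominates c I f"
  shows "smile_minus.F f I = c"
proof -
  from assms obtain i where "i \<in> I" "f i = c" and c0: "c \<noteq> 0"
    unfolding dominates_def by auto
  with assms have "\<bar>c\<bar> \<le> \<bar>smile_minus.F f I\<bar>"
    using smile_minus_bound[of I i f] by auto
  moreover from this c0 have "smile_minus.F f I \<in> f ` I"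
    using smile_minus_in[OF assms(1), of f] by auto
  ultimately show ?thesis
    using assms(2) unfolding dominates_def by (smt (verit) imageE)
qed

lemma smile_plus_eq_dominating:
  assumes "finite I" "dominates c I f"
  shows "smile_plus.F f I = c"
proof -
  from assms obtain i where "i \<in> I" "f i = c" and c0: "c \<noteq> 0"
    unfolding dominates_def by auto
  with assms have "\<bar>c\<bar> \<le> \<bar>smile_plus.F f I\<bar>"
    using smile_plus_bound[of I i f] by auto
  moreover from this c0 have "smile_plus.F f I \<in> f ` I"
    using smile_plus_in[OF assms(1), of f] by auto
  ultimately show ?thesis
    using assms(2) unfolding dominates_def by (smt (verit) imageE)
qed

text \<open>Ties are resolved downwards, so a positive result excludes an entry \<open>- c\<close>.\<close>

lemma smile_minus_pos_dominates:
  assumes "finite I" "smile_minus.F f I = c" "c > 0"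
  shows "dominates c I f"
  unfolding dominates_def
  using smile_minus_in[OF assms(1), of f] smile_minus_bound[OF assms(1), of _ f] assms(2,3)
  by (fastforce simp: image_iff)

lemma Max_eq_dominating:
  assumes "finite I" "dominates c I f" "c > 0"
  shows "Max (f ` I) = c"
  using assms unfolding dominates_def by (intro Max_eqI) fastforce+

section \<open>Regular solutions\<close>

text \<open>For a positive right-hand side, the three inner products and the two inequalities of the
  limit system all reduce to one domination condition for each row.\<close>

lemma regular_solution_iff_dominates:
  fixes A :: "real ^ 'n ^ 'n" and b x :: "real ^ 'n"
  assumes "\<forall>i. b $ i > 0"
  shows "regular_solution A b x \<longleftrightarrow> (\<forall>i. dominates (b $ i) UNIV (\<lambda>j. A $ i $ j * x $ j))"
proof
  assume reg: "regular_solution A b x"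
  show "\<forall>i. dominates (b $ i) UNIV (\<lambda>j. A $ i $ j * x $ j)"
  proof
    fix i
    have "inner_minus (A $ i) x \<le> b $ i" and "b $ i \<le> inner_plus (A $ i) x"
      using reg unfolding regular_solution_def limit_solution_def less_eq_vec_def
        boxtimes_minus_def boxtimes_plus_def vec_lambda_beta by blast+
    moreover have "inner_minus (A $ i) x = inner_plus (A $ i) x"
      using reg unfolding regular_solution_def by blast
    ultimately have "inner_minus (A $ i) x = b $ i" by linarith
    then show "dominates (b $ i) UNIV (\<lambda>j. A $ i $ j * x $ j)"
      using assms by (intro smile_minus_pos_dominates) (auto simp: inner_minus_def)
  qed
next
  assume dom: "\<forall>i. dominates (b $ i) UNIV (\<lambda>j. A $ i $ j * x $ j)"
  have "inner_inf (A $ i) x = b $ i" "inner_minus (A $ i) x = b $ i"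
    "inner_plus (A $ i) x = b $ i" for i
    using dom unfolding inner_inf_def inner_minus_def inner_plus_def
    by (simp_all add: boxplus_eq_dominating smile_minus_eq_dominating smile_plus_eq_dominating)
  then show "regular_solution A b x"
    unfolding regular_solution_def limit_solution_def less_eq_vec_def
    by (simp add: boxtimes_minus_def boxtimes_plus_def)
qed

lemma max_solution_if_dominates:
  fixes A :: "real ^ 'n ^ 'n" and b x :: "real ^ 'n"
  assumes "\<forall>i. b $ i > 0" "\<forall>i. dominates (b $ i) UNIV (\<lambda>j. A $ i $ j * x $ j)"
  shows "max_solution A b x"
  using assms by (simp add: max_solution_def Max_eq_dominating)

lemma dominates_positive_part:
  assumes "c > 0" "dominates c I f"
  shows "dominates c I (\<lambda>i. max (f i) 0)"
  using assms unfolding dominates_def by (force simp: image_iff max_def)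

section \<open>Determinants in limit and Cramer's rule\<close>

text \<open>Let column scalings \<open>v\<close> make the entries of row \<open>i\<close> at most \<open>u\<^sub>i\<close>, with equality
  along \<open>\<sigma>\<close>. Since a permutation meets each row and each column once, its product of scaled
  entries is \<open>\<Prod>v\<close> times its original product and at most \<open>\<Prod>u\<close>. If every other permutation
  meets a strict inequality somewhere, the term of \<open>\<sigma>\<close> dominates. The strictness hypothesis is
  stated for permutations instead of entries because a column replaced by \<open>b\<close> is tight
  throughout.\<close>

lemma det_inf_eq_optimal_term:
  fixes A :: "real ^ 'n ^ 'n" and u v :: "'n \<Rightarrow> real"
  assumes nonneg: "\<And>i j. A $ i $ j \<ge> 0"
    and u: "\<And>i. u i > 0" and v: "\<And>j. v j > 0"
    and perm: "\<sigma> permutes UNIV"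
    and le: "\<And>i j. A $ i $ j * v j \<le> u i"
    and tight: "\<And>i. A $ i $ \<sigma> i * v (\<sigma> i) = u i"
    and strict: "\<And>p. p permutes UNIV \<Longrightarrow> p \<noteq> \<sigma> \<Longrightarrow> \<exists>i. A $ i $ p i * v (p i) < u i"
  shows "det_inf A = of_int (sign \<sigma>) * ((\<Prod>i\<in>UNIV. u i) / (\<Prod>j\<in>UNIV. v j))"
proof -
  let ?c = "(\<Prod>i\<in>UNIV. u i) / (\<Prod>j\<in>UNIV. v j)"
  let ?P = "\<lambda>p. \<Prod>i\<in>UNIV. A $ i $ p i"
  have V: "(\<Prod>j\<in>UNIV. v j) > 0" and c: "?c > 0"
    using u v by (simp_all add: prod_pos)
  have scaled: "(\<Prod>i\<in>UNIV. A $ i $ p i * v (p i)) = ?P p * (\<Prod>j\<in>UNIV. v j)"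
    if "p permutes UNIV" for p
    using prod.permute[OF that, of v] by (simp add: prod.distrib o_def)
  have opt: "?P \<sigma> = ?c"
    using scaled[OF perm] V by (simp add: tight eq_divide_eq del: prod_zero_iff)
  have less: "?P p < ?c" if p: "p permutes UNIV" "p \<noteq> \<sigma>" for p
  proof -
    from strict[OF p] obtain i where "A $ i $ p i * v (p i) < u i" ..
    then have "(\<Prod>i\<in>UNIV. A $ i $ p i * v (p i)) < (\<Prod>i\<in>UNIV. u i)"
      using nonneg le u v by (intro prod_mono_strict[of i]) (simp_all add: less_imp_le)
    then show ?thesis
      using scaled[OF p(1)] V by (simp add: less_divide_eq)
  qed
  have abs_term: "\<bar>of_int (sign p) * ?P p\<bar> = ?P p" for p
    using nonneg by (simp add: abs_mult sign_def prod_nonneg)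
  let ?s = "of_int (sign \<sigma>) :: real"
  let ?I = "{p. p permutes (UNIV :: 'n set)}"
  let ?t = "\<lambda>p. of_int (sign p) * ?P p"
  have abs_c: "\<bar>?s * ?c\<bar> = ?c"
    using abs_term[of \<sigma>] by (simp only: opt)
  have "dominates (?s * ?c) ?I ?t"
    unfolding dominates_def
  proof (intro conjI ballI)
    show c0: "?s * ?c \<noteq> 0" using c abs_c by linarith
    show "?s * ?c \<in> ?t ` ?I"
      using perm opt by (intro image_eqI[of _ _ \<sigma>]) auto
    show "- (?s * ?c) \<notin> ?t ` ?I"
    proof
      assume "- (?s * ?c) \<in> ?t ` ?I"
      then obtain p where p: "p permutes UNIV" and eq: "?t p = - (?s * ?c)" by auto
      then have "?P p = ?c"
        using abs_term[of p] abs_c by linarith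
      with less[OF p] have "p = \<sigma>" by auto
      with eq have "?s * ?c = - (?s * ?c)" by (simp only: opt)
      with c0 show False by (simp only: equal_neg_zero)
    qed
    show "\<bar>?t p\<bar> \<le> \<bar>?s * ?c\<bar>" if "p \<in> ?I" for p
      unfolding abs_term abs_c using that less[of p] opt by (cases "p = \<sigma>") auto
  qed
  then show ?thesis
    unfolding det_inf_def by (intro boxplus_eq_dominating) simp
qed

lemma cramer_inf_nth: "cramer_inf A b $ k = det_inf (replace_column A b k) / det_inf A"
  unfolding cramer_inf_def by (simp add: axis_def if_distrib[of "\<lambda>t. _ * t"] cong: if_cong)

text \<open>Cramer's rule for a vector whose products \<open>a\<^sub>i\<^sub>j x\<^sub>j\<close> attain \<open>b\<^sub>i\<close> along \<open>\<sigma>\<close> and are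
  smaller elsewhere: both determinants are governed by \<open>\<sigma>\<close>, with scalings that differ only in
  their factor for column \<open>k\<close>.\<close>

lemma cramer_inf_eq_strictly_tight:
  fixes A :: "real ^ 'n ^ 'n" and b x :: "real ^ 'n"
  assumes nonneg: "\<And>i j. A $ i $ j \<ge> 0"
    and b: "\<And>i. b $ i > 0" and x: "\<And>j. x $ j > 0"
    and perm: "\<sigma> permutes UNIV"
    and tight: "\<And>i. A $ i $ \<sigma> i * x $ \<sigma> i = b $ i"
    and strict: "\<And>i j. j \<noteq> \<sigma> i \<Longrightarrow> A $ i $ j * x $ j < b $ i"
  shows "det_inf A \<noteq> 0" and "cramer_inf A b = x"
proof -
  have le: "A $ i $ j * x $ j \<le> b $ i" for i j
    using tight strict by (cases "j = \<sigma> i") (auto simp: less_imp_le)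
  have det: "det_inf A = of_int (sign \<sigma>) * ((\<Prod>i\<in>UNIV. b $ i) / (\<Prod>j\<in>UNIV. x $ j))"
  proof (rule det_inf_eq_optimal_term[OF nonneg b x perm le tight])
    fix p :: "'n \<Rightarrow> 'n" assume "p \<noteq> \<sigma>"
    then obtain i where "p i \<noteq> \<sigma> i" by blast
    then show "\<exists>i. A $ i $ p i * x $ p i < b $ i" using strict by blast
  qed
  have s0: "of_int (sign \<sigma>) \<noteq> (0 :: real)" by (simp add: sign_def)
  have B: "(\<Prod>i\<in>UNIV. b $ i) > 0" and X: "(\<Prod>j\<in>UNIV. x $ j) > 0"
    using b x by (simp_all add: prod_pos)
  show det0: "det_inf A \<noteq> 0" using det s0 B X by (simp del: prod_zero_iff)
  have "det_inf (replace_column A b k) / det_inf A = x $ k" for k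
  proof -
    let ?v = "\<lambda>j. if j = k then 1 else x $ j"
    let ?V = "\<Prod>j\<in>UNIV. ?v j"
    have "det_inf (replace_column A b k) = of_int (sign \<sigma>) * ((\<Prod>i\<in>UNIV. b $ i) / ?V)"
    proof (rule det_inf_eq_optimal_term[OF _ b _ perm])
      fix p :: "'n \<Rightarrow> 'n" assume p: "p permutes UNIV" "p \<noteq> \<sigma>"
      \<comment> \<open>If \<open>p\<close> left \<open>\<sigma>\<close> only in the row that it sends to \<open>k\<close>, then that row and the row that
        \<open>\<sigma>\<close> sends to \<open>k\<close> would have the same image under \<open>p\<close>.\<close>
      have "\<exists>i. p i \<noteq> k \<and> p i \<noteq> \<sigma> i"
      proof (rule ccontr)
        assume "\<not> ?thesis"
        then have agree: "p i = k \<or> p i = \<sigma> i" for i by blast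
        from p obtain i where i: "p i \<noteq> \<sigma> i" by blast
        obtain i' where i': "\<sigma> i' = k"
          using permutes_surj[OF perm] by (metis surjD)
        have "p i = p i'" using agree[of i] agree[of i'] i i' by auto
        then have "i = i'" using permutes_inj[OF p(1)] by (simp add: inj_eq)
        with agree[of i] i i' show False by auto
      qed
      then obtain i where "p i \<noteq> k" "p i \<noteq> \<sigma> i" by blast
      then show "\<exists>i. replace_column A b k $ i $ p i * ?v (p i) < b $ i"
        using strict[of "p i" i] by (intro exI[of _ i]) (simp add: replace_column_def)
    qed (use nonneg b x le tight in \<open>auto simp: replace_column_def less_imp_le\<close>)
    moreover have "(\<Prod>j\<in>UNIV. x $ j) = x $ k * ?V"
      by (subst (1 2) prod.remove[of _ k]) (auto intro!: prod.cong)
    moreover have "?V > 0" using x by (simp add: prod_pos)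
    ultimately show ?thesis
      using det s0 B x[of k] by (simp del: prod_zero_iff)
  qed
  then show "cramer_inf A b = x" by (simp add: vec_eq_iff cramer_inf_nth)
qed

section \<open>Solutions of the max-equations\<close>

theorem proposition5p2p5:
  fixes A :: "real ^ 'n ^ 'n" and b :: "real ^ 'n"
  assumes A_nonneg: "\<forall>i j. A $ i $ j \<ge> 0"
    and b_pos: "\<forall>i. b $ i > 0"
  shows "((\<exists>\<sigma>. \<sigma> permutes (UNIV :: 'n set) \<and>
             (\<forall>i. A $ i $ \<sigma> i > 0 \<and>
                  (\<forall>j \<in> UNIV - {i}. b $ i > A $ i $ \<sigma> j * (b $ j / A $ j $ \<sigma> j))))
          \<longrightarrow> det_inf A \<noteq> 0 \<and> (\<forall>i. cramer_inf A b $ i \<ge> 0) \<and>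
              max_solution A b (cramer_inf A b))
       \<and> (det_inf A \<noteq> 0 \<and> regular_solution A b (cramer_inf A b) \<and>
            (\<forall>y. regular_solution A b y \<longrightarrow> y = cramer_inf A b)
          \<longrightarrow> (\<forall>i. cramer_inf A b $ i \<ge> 0) \<and> max_solution A b (cramer_inf A b))"
proof (intro conjI[of "_ \<longrightarrow> _"] impI)
  assume "\<exists>\<sigma>. \<sigma> permutes (UNIV :: 'n set) \<and>
             (\<forall>i. A $ i $ \<sigma> i > 0 \<and>
                  (\<forall>j \<in> UNIV - {i}. b $ i > A $ i $ \<sigma> j * (b $ j / A $ j $ \<sigma> j)))"
  then obtain \<sigma> where perm: "\<sigma> permutes (UNIV :: 'n set)"
    and pos: "\<And>i. A $ i $ \<sigma> i > 0"
    and dom: "\<And>i j. j \<noteq> i \<Longrightarrow> b $ i > A $ i $ \<sigma> j * (b $ j / A $ j $ \<sigma> j)"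
    by auto
  \<comment> \<open>\<open>x\<^sub>k\<close> makes column \<open>k\<close> attain the right-hand side in the row that \<open>\<sigma>\<close> matches with \<open>k\<close>.\<close>
  define x :: "real ^ 'n" where "x = (\<chi> k. b $ inv \<sigma> k / A $ inv \<sigma> k $ k)"
  have x: "x $ \<sigma> j = b $ j / A $ j $ \<sigma> j" for j
    using permutes_inverses[OF perm] by (simp add: x_def)
  have onto: "\<exists>j. k = \<sigma> j" for k
    using permutes_surj[OF perm] by (metis surjD)
  have x_pos: "x $ k > 0" for k
    using onto[of k] x pos b_pos by auto
  have tight: "A $ i $ \<sigma> i * x $ \<sigma> i = b $ i" for i
    using pos[of i] by (simp add: x)
  have strict: "A $ i $ k * x $ k < b $ i" if "k \<noteq> \<sigma> i" for i k
    using onto[of k] dom that by (metis x)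
  have "dominates (b $ i) UNIV (\<lambda>j. A $ i $ j * x $ j)" for i
  proof -
    have "0 \<le> A $ i $ j * x $ j" for j
      using A_nonneg less_imp_le[OF x_pos[of j]] by simp
    moreover have "A $ i $ j * x $ j \<le> b $ i" for j
      using tight[of i] strict[of j i] by (cases "j = \<sigma> i") auto
    moreover have "b $ i > 0" using b_pos by blast
    ultimately show ?thesis
      using tight[of i] unfolding dominates_def image_iff
      by (intro conjI) (force, metis UNIV_I, smt (verit), force)
  qed
  then have "max_solution A b x"
    using b_pos by (intro max_solution_if_dominates) auto
  moreover have "det_inf A \<noteq> 0" "cramer_inf A b = x"
    using cramer_inf_eq_strictly_tight[OF _ _ x_pos perm tight strict] A_nonneg b_pos by blast+
  ultimately show "det_inf A \<noteq> 0 \<and> (\<forall>i. cramer_inf A b $ i \<ge> 0) \<and>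
              max_solution A b (cramer_inf A b)"
    using x_pos by (simp add: less_imp_le)
next
  assume asm: "det_inf A \<noteq> 0 \<and> regular_solution A b (cramer_inf A b) \<and>
            (\<forall>y. regular_solution A b y \<longrightarrow> y = cramer_inf A b)"
  define x where "x = cramer_inf A b"
  have dom: "\<forall>i. dominates (b $ i) UNIV (\<lambda>j. A $ i $ j * x $ j)"
    using asm regular_solution_iff_dominates[OF b_pos] by (simp add: x_def)
  define y :: "real ^ 'n" where "y = (\<chi> j. max (x $ j) 0)"
  have "A $ i $ j * y $ j = max (A $ i $ j * x $ j) 0" for i j
    using A_nonneg by (simp add: y_def max_mult_distrib_left)
  then have "regular_solution A b y"
    unfolding regular_solution_iff_dominates[OF b_pos]
    using dom b_pos by (simp add: dominates_positive_part)
  then have "y = x" using asm by (simp add: x_def)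
  moreover have "\<forall>i. y $ i \<ge> 0" by (simp add: y_def)
  moreover have "max_solution A b x" using max_solution_if_dominates[OF b_pos dom] .
  ultimately show "(\<forall>i. cramer_inf A b $ i \<ge> 0) \<and> max_solution A b (cramer_inf A b)"
    by (simp add: x_def)
qed

end
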